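(* Let $q$ be a power of a prime $p$ with $q\equiv 1\pmod 4$. Then there are odd and absolutely irreducible representations $\rho_1,\rho_2,\rho_3:\mathrm{Gal}(\overline{\mathbb{Q}}/\mathbb{Q})\to\mathrm{GL}_2(\mathbb{F}_q)$ such that for all $m\geq 1$, there are no orderly primes of order $m$ for $\rho_1\oplus\rho_2\oplus\rho_3$.
   Context: Representations of $G_{\mathbb{Q}}=\mathrm{Gal}(\overline{\mathbb{Q}}/\mathbb{Q})$ are continuous. A representation $\rho$ over $\mathbb{F}_q$ ($q$ odd) is odd if $\det\rho(c)=-1$ for $c$ a complex conjugation, and absolutely irreducible if it remains irreducible over $\overline{\mathbb{F}}_q$. For a mod $p$ representation $\rho:G_{\mathbb{Q}}\to\mathrm{GL}_r(\mathbb{F}_q)$ and a positive integer $m$, a prime $\ell$ is called orderly of order $m$ for $\rho$ if (1) $\ell\equiv 1\pmod{p^m}$; (2) $\rho$ is unramified at $\ell$; (3) $\rho(\mathrm{Frob}_\ell)$ does not have $1$ as an eigenvalue. *)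

theory Defs
  imports
    "HOL-Analysis.Analysis"
    "HOL-Algebra.Bij"
    "HOL-Algebra.Ideal"
    "HOL-Algebra.Algebraic_Closure_Type"
    "HOL-Number_Theory.Cong"
begin

section \<open>The absolute Galois group of the rationals\<close>

definition Qbar :: "complex ring" where
  "Qbar = ring_of_type_algebra\<lparr>carrier := {z. algebraic z}\<rparr>"

definition Zbar :: "complex ring" where
  "Zbar = ring_of_type_algebra\<lparr>carrier := {z. algebraic_int z}\<rparr>"

text \<open>
  As in \<^const>\<open>BijGroup\<close>, automorphisms are functions on the carrier of \<open>Qbar\<close>,
  taken to be \<^const>\<open>undefined\<close> outside of it.
\<close>

definition GalQ :: "(complex \<Rightarrow> complex) monoid" where
  "GalQ = (BijGroup (carrier Qbar))
     \<lparr>carrier := {\<sigma> \<in> Bij (carrier Qbar) \<inter> ring_hom Qbar Qbar. \<forall>x\<in>\<rat>. \<sigma> x = x}\<rparr>"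

text \<open>
  The Krull topology. The automorphisms fixing a finite set \<open>S\<close> pointwise form the subgroup
  \<open>Gal(Qbar / Q(S))\<close>, and \<open>Q(S)\<close> runs through all finite subextensions of \<open>Qbar / Q\<close>; the
  generating sets below are thus exactly the cosets of the subgroups \<open>Gal(Qbar / K)\<close>
  with \<open>K\<close> finite over \<open>Q\<close>.
\<close>

definition krull_topology :: "(complex \<Rightarrow> complex) topology" where
  "krull_topology = topology_generated_by
     {{\<tau> \<in> carrier GalQ. \<forall>x\<in>S. \<tau> x = \<sigma> x} | \<sigma> S.
        \<sigma> \<in> carrier GalQ \<and> finite S \<and> S \<subseteq> carrier Qbar}"

definition complex_conj :: "complex \<Rightarrow> complex" where
  "complex_conj = restrict cnj (carrier Qbar)"


section \<open>Primes, inertia and Frobenius elements\<close>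

definition primes_above :: "nat \<Rightarrow> complex set set" where
  "primes_above l = {P. primeideal P Zbar \<and> of_nat l \<in> P}"

definition decomposition_group :: "complex set \<Rightarrow> (complex \<Rightarrow> complex) set" where
  "decomposition_group P = {\<sigma> \<in> carrier GalQ. \<sigma> ` P = P}"

definition inertia_group :: "complex set \<Rightarrow> (complex \<Rightarrow> complex) set" where
  "inertia_group P = {\<sigma> \<in> decomposition_group P. \<forall>x\<in>carrier Zbar. \<sigma> x - x \<in> P}"

text \<open>The arithmetic Frobenius elements at all primes of \<open>Zbar\<close> above \<open>l\<close>.\<close>

definition frobenius_elements :: "nat \<Rightarrow> (complex \<Rightarrow> complex) set" where
  "frobenius_elements l =
     (\<Union>P\<in>primes_above l. {\<sigma> \<in> decomposition_group P. \<forall>x\<in>carrier Zbar. \<sigma> x - x ^ l \<in> P})"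


section \<open>Galois representations\<close>

definition GL :: "('k::field ^ 'n ^ 'n) monoid" where
  "GL = \<lparr>carrier = {A. invertible A}, monoid.mult = (**), one = mat 1\<rparr>"

definition galois_rep :: "((complex \<Rightarrow> complex) \<Rightarrow> 'k::{field,finite} ^ 'n ^ 'n) \<Rightarrow> bool" where
  "galois_rep \<rho> \<longleftrightarrow> \<rho> \<in> hom GalQ GL
     \<and> continuous_map krull_topology (discrete_topology (carrier GL)) \<rho>"

definition odd_rep :: "((complex \<Rightarrow> complex) \<Rightarrow> 'k::field ^ 'n ^ 'n) \<Rightarrow> bool" where
  "odd_rep \<rho> \<longleftrightarrow> det (\<rho> complex_conj) = -1"

definition irreducible_rep :: "((complex \<Rightarrow> complex) \<Rightarrow> 'k::field ^ 'n ^ 'n) \<Rightarrow> bool" where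
  "irreducible_rep \<rho> \<longleftrightarrow>
     (\<forall>W. vec.subspace W \<and> (\<forall>\<sigma>\<in>carrier GalQ. \<forall>w\<in>W. \<rho> \<sigma> *v w \<in> W) \<longrightarrow> W = {0} \<or> W = UNIV)"

definition absolutely_irreducible_rep ::
    "((complex \<Rightarrow> complex) \<Rightarrow> 'k::field ^ 'n ^ 'n) \<Rightarrow> bool" where
  "absolutely_irreducible_rep \<rho> \<longleftrightarrow> irreducible_rep (\<lambda>\<sigma>. map_matrix to_ac (\<rho> \<sigma>))"

definition block_diag ::
    "'k::zero ^ 'm ^ 'm \<Rightarrow> 'k ^ 'n ^ 'n \<Rightarrow> 'k ^ ('m + 'n) ^ ('m + 'n)" where
  "block_diag A B = (\<chi> i j. case (i, j) of
      (Inl a, Inl b) \<Rightarrow> A $ a $ b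
    | (Inr a, Inr b) \<Rightarrow> B $ a $ b
    | _ \<Rightarrow> 0)"

definition direct_sum_rep ::
    "('g \<Rightarrow> 'k::zero ^ 'm ^ 'm) \<Rightarrow> ('g \<Rightarrow> 'k ^ 'n ^ 'n) \<Rightarrow> 'g \<Rightarrow> 'k ^ ('m + 'n) ^ ('m + 'n)"
    (infixr \<open>\<oplus>\<^sub>r\<close> 65) where
  "(\<rho> \<oplus>\<^sub>r \<rho>') \<sigma> = block_diag (\<rho> \<sigma>) (\<rho>' \<sigma>)"

definition unramified_at :: "((complex \<Rightarrow> complex) \<Rightarrow> 'k::field ^ 'n ^ 'n) \<Rightarrow> nat \<Rightarrow> bool" where
  "unramified_at \<rho> l \<longleftrightarrow> (\<forall>P\<in>primes_above l. \<forall>\<sigma>\<in>inertia_group P. \<rho> \<sigma> = mat 1)"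

definition is_eigenvalue :: "'k::field ^ 'n ^ 'n \<Rightarrow> 'k \<Rightarrow> bool" where
  "is_eigenvalue A c \<longleftrightarrow> (\<exists>v. v \<noteq> 0 \<and> A *v v = c *s v)"

text \<open>
  If \<open>\<rho>\<close> is unramified at \<open>l\<close>, all Frobenius elements at \<open>l\<close> have conjugate images, so the
  last condition does not depend on which one is taken as \<open>Frob\<^sub>l\<close>. With the existential
  quantifier, the absence of orderly primes is asserted for every choice of \<open>Frob\<^sub>l\<close>.
\<close>

definition orderly ::
    "nat \<Rightarrow> nat \<Rightarrow> ((complex \<Rightarrow> complex) \<Rightarrow> 'k::field ^ 'n ^ 'n) \<Rightarrow> nat \<Rightarrow> bool" where
  "orderly p m \<rho> l \<longleftrightarrow> Factorial_Ring.prime l \<and> [l = 1] (mod p ^ m) \<and> unramified_at \<rho> l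
     \<and> (\<exists>\<sigma>\<in>frobenius_elements l. \<not> is_eigenvalue (\<rho> \<sigma>) 1)"

end

theory Submission
  imports Defs
begin

text \<open>
  Let \<open>s\<close> be a square root of \<open>\<alpha> \<in> \<rat>(\<i>) - \<rat>\<close>. The Galois group permutes \<open>\<plusminus>s, \<plusminus>cnj s\<close>, acting on
  \<open>(s, cnj s)\<close> through signed permutation matrices; this is a dihedral representation over any
  field, induced from the quadratic character of \<open>\<rat>(\<i>, s)\<close> over \<open>\<rat>(\<i>)\<close>. It is odd because
  complex conjugation swaps \<open>s\<close> and \<open>cnj s\<close>, and absolutely irreducible in odd characteristic
  if \<open>s * cnj s\<close>, a square root of the norm of \<open>\<alpha>\<close>, is irrational.

  Take \<open>\<alpha> = 1 + 2\<i>\<close>, \<open>\<beta> = 1 + \<i>\<close> and \<open>\<alpha>\<beta>\<close>, with roots \<open>s\<close>, \<open>t\<close> and \<open>s t\<close>. If \<open>\<sigma>\<close> fixes \<open>\<i>\<close>, it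
  acts on \<open>s\<close>, \<open>t\<close>, \<open>s t\<close> by signs whose product is \<open>1\<close>, so one of them is \<open>1\<close>, and is an
  eigenvalue. Otherwise \<open>\<sigma>\<close> acts by an antidiagonal matrix, which has the eigenvalue \<open>1\<close> as soon
  as \<open>\<sigma>\<close> fixes \<open>s * cnj s\<close> (or its analogue for \<open>t\<close>, \<open>s t\<close>), and the same argument applies to these
  three signs. Hence every element of the Galois group has eigenvalue \<open>1\<close> in one of the three
  representations.
\<close>

section \<open>The field of algebraic numbers\<close>

lemma map_poly_of_int_eq_0_iff:
  "map_poly (of_int :: int \<Rightarrow> 'a :: ring_char_0) p = 0 \<longleftrightarrow> p = 0"
  by (auto simp: poly_eq_iff coeff_map_poly)

text \<open>Bridge between the two kinds of polynomials: \<open>ring.eval\<close> reads coefficient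
  lists from the leading coefficient down, \<open>Poly\<close> from the constant term up, whence the
  \<open>rev\<close>.\<close>

lemma eval_ring_of_type_algebra:
  "ring.eval (ring_of_type_algebra :: 'a :: field ring) xs x = poly (Poly (rev xs)) x"
proof -
  interpret R: ring "ring_of_type_algebra :: 'a ring"
    by (rule ring_from_type_algebra)
  have pow: "x [^]\<^bsub>ring_of_type_algebra\<^esub> n = x ^ n" for n :: nat
    by (induction n) (simp_all add: ring_of_type_algebra_def nat_pow_def)
  show ?thesis
  proof (induction xs)
    case (Cons a xs)
    then show ?case
      by (simp add: pow Poly_append poly_monom) (simp add: ring_of_type_algebra_def)
  qed (simp, simp add: ring_of_type_algebra_def)
qed

lemma subfield_Rats: "subfield (\<rat> :: complex set) ring_of_type_algebra"
proof -
  interpret R: field "ring_of_type_algebra :: complex ring"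
    by (rule field_from_type_algebra)
  show ?thesis
  proof (rule R.subfieldI')
    have "\<ominus>\<^bsub>ring_of_type_algebra\<^esub> h = - h" for h :: complex
      by (rule R.minus_equality) (simp_all add: ring_of_type_algebra_def)
    then show "subring (\<rat> :: complex set) ring_of_type_algebra"
      by (intro R.subringI) (simp_all, simp_all add: ring_of_type_algebra_def)
    show "inv\<^bsub>ring_of_type_algebra\<^esub> k \<in> \<rat>" if "k \<in> \<rat> - {\<zero>\<^bsub>ring_of_type_algebra\<^esub>}" for k :: complex
    proof -
      have "k \<noteq> 0" "k \<in> \<rat>"
        using that by (simp_all add: ring_of_type_algebra_def)
      then have "inv\<^bsub>ring_of_type_algebra\<^esub> k = inverse k"
        by (intro R.comm_inv_char) (simp_all add: ring_of_type_algebra_def)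
      with \<open>k \<in> \<rat>\<close> show ?thesis
        by simp
    qed
  qed
qed

text \<open>Identifying the two notions of algebraicity makes the theory of field extensions
  available for \<open>algebraic\<close>.\<close>

lemma algebraic_iff_algebraic_over_Rats:
  "algebraic (x :: complex) \<longleftrightarrow> (ring.algebraic ring_of_type_algebra over \<rat>) x"
proof -
  interpret R: field "ring_of_type_algebra :: complex ring"
    by (rule field_from_type_algebra)
  have sub: "subring (\<rat> :: complex set) ring_of_type_algebra"
    by (rule subfieldE(1)[OF subfield_Rats])
  show ?thesis
  proof
    assume "algebraic x"
    then obtain p where p: "\<And>i. Polynomial.coeff p i \<in> \<rat>" "p \<noteq> 0" "poly p x = 0"
      unfolding algebraic_altdef by blast
    have "rev (coeffs p) \<in> carrier (\<rat>[X]\<^bsub>ring_of_type_algebra\<^esub>)"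
      using p(1,2) by (auto simp: univ_poly_carrier[symmetric] polynomial_def hd_rev
          last_coeffs_eq_coeff_degree coeffs_def ring_of_type_algebra_def)
    then show "(ring.algebraic ring_of_type_algebra over \<rat>) x"
      by (rule R.algebraicI)
        (use p in \<open>simp_all add: eval_ring_of_type_algebra\<close>, simp add: ring_of_type_algebra_def)
  next
    assume "(ring.algebraic ring_of_type_algebra over \<rat>) x"
    then obtain xs where xs: "xs \<in> carrier (\<rat>[X]\<^bsub>ring_of_type_algebra\<^esub>)" "xs \<noteq> []"
      "ring.eval ring_of_type_algebra xs x = \<zero>\<^bsub>ring_of_type_algebra\<^esub>"
      by (rule R.algebraicE[OF sub, rotated]) (simp_all add: ring_of_type_algebra_def)
    then have "set xs \<subseteq> \<rat>" "hd xs \<noteq> 0"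
      by (auto simp: univ_poly_carrier[symmetric] polynomial_def ring_of_type_algebra_def)
    show "algebraic x"
    proof (rule algebraicI')
      show "Polynomial.coeff (Poly (rev xs)) i \<in> \<rat>" for i
        using \<open>set xs \<subseteq> \<rat>\<close> nth_mem[of _ "rev xs"] by (auto simp: coeff_Poly_eq nth_default_def simp del: nth_mem)
      \<comment> \<open>The head of \<open>xs\<close> is the coefficient of degree
        \<open>length (tl xs)\<close> and is nonzero.\<close>
      show "Poly (rev xs) \<noteq> 0"
        using \<open>hd xs \<noteq> 0\<close> \<open>xs \<noteq> []\<close>
        by (cases xs) (auto simp: poly_eq_iff coeff_Poly_eq nth_default_def nth_append intro!: exI[of _ "length (tl xs)"])
      show "poly (Poly (rev xs)) x = 0"
        using xs(3) by (simp only: eval_ring_of_type_algebra) (simp add: ring_of_type_algebra_def)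
    qed
  qed
qed

text \<open>The elements of a field extension that are algebraic over the base field form a
  subfield; here this is read over \<rat>.\<close>

lemma
  fixes x y :: complex
  assumes "algebraic x" "algebraic y"
  shows algebraic_add: "algebraic (x + y)" and algebraic_mult: "algebraic (x * y)"
proof -
  interpret R: field "ring_of_type_algebra :: complex ring"
    by (rule field_from_type_algebra)
  have "subring {x :: complex. algebraic x} ring_of_type_algebra"
    using subfieldE(1)[OF R.subfield_of_algebraics[OF subfield_Rats]]
    by (simp add: algebraic_iff_algebraic_over_Rats ring_of_type_algebra_def)
  from subringE(6,7)[OF this] assms show "algebraic (x + y)" "algebraic (x * y)"
    by (simp_all add: ring_of_type_algebra_def)
qed

lemma algebraic_sum:
  "(\<And>i. i \<in> A \<Longrightarrow> algebraic (f i :: complex)) \<Longrightarrow> algebraic (sum f A)"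
  by (induction A rule: infinite_finite_induct) (auto intro: algebraic_add)

lemma algebraic_power: "algebraic (x :: complex) \<Longrightarrow> algebraic (x ^ n)"
  by (induction n) (auto intro: algebraic_mult rat_imp_algebraic)

section \<open>Extension of automorphisms\<close>

text \<open>
  Partially defined automorphisms are handled through their graphs, as subrings of
  \<open>\<complex> \<times> \<complex>\<close> that contain the diagonal copy of \<open>\<rat>\<close>.
\<close>

locale ring_graph =
  fixes \<Gamma> :: "(complex \<times> complex) set"
  assumes Rats: "r \<in> \<rat> \<Longrightarrow> (r, r) \<in> \<Gamma>"
    and add: "(x, y) \<in> \<Gamma> \<Longrightarrow> (x', y') \<in> \<Gamma> \<Longrightarrow> (x + x', y + y') \<in> \<Gamma>"
    and mult: "(x, y) \<in> \<Gamma> \<Longrightarrow> (x', y') \<in> \<Gamma> \<Longrightarrow> (x * x', y * y') \<in> \<Gamma>"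
    and alg: "(x, y) \<in> \<Gamma> \<Longrightarrow> algebraic x"
    and zero: "(0, y) \<in> \<Gamma> \<Longrightarrow> y = 0"
begin

lemma diff: "(x, y) \<in> \<Gamma> \<Longrightarrow> (x', y') \<in> \<Gamma> \<Longrightarrow> (x - x', y - y') \<in> \<Gamma>"
  using add[of x y "- x'" "- y'"] mult[OF Rats[of "-1"], of x' y'] by simp

text \<open>Subtracting the two pairs reduces single-valuedness to the value at 0, so the assumption
  \<open>zero\<close> suffices.\<close>

lemma functional: "(x, y) \<in> \<Gamma> \<Longrightarrow> (x, y') \<in> \<Gamma> \<Longrightarrow> y = y'"
  using diff[of x y x y'] zero[of "y - y'"] by simp

lemma sum: "(\<And>i. i \<in> A \<Longrightarrow> (f i, g i) \<in> \<Gamma>) \<Longrightarrow> (sum f A, sum g A) \<in> \<Gamma>"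
  by (induction A rule: infinite_finite_induct) (auto intro: add Rats)

text \<open>Thinking of \<Gamma> as a partial homomorphism, \<open>q\<close> is obtained from
  \<open>p\<close> by applying it to each coefficient.\<close>

definition poly_rel :: "complex poly \<Rightarrow> complex poly \<Rightarrow> bool" where
  "poly_rel p q \<longleftrightarrow> (\<forall>i. (Polynomial.coeff p i, Polynomial.coeff q i) \<in> \<Gamma>)"

lemma poly_relD: "poly_rel p q \<Longrightarrow> (Polynomial.coeff p i, Polynomial.coeff q i) \<in> \<Gamma>"
  by (simp add: poly_rel_def)

lemma poly_rel_add: "poly_rel p q \<Longrightarrow> poly_rel p' q' \<Longrightarrow> poly_rel (p + p') (q + q')"
  by (simp add: poly_rel_def add)

lemma poly_rel_diff: "poly_rel p q \<Longrightarrow> poly_rel p' q' \<Longrightarrow> poly_rel (p - p') (q - q')"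
  by (simp add: poly_rel_def diff)

lemma poly_rel_mult: "poly_rel p q \<Longrightarrow> poly_rel p' q' \<Longrightarrow> poly_rel (p * p') (q * q')"
  by (simp add: poly_rel_def coeff_mult sum mult)

lemma poly_rel_monom: "(x, y) \<in> \<Gamma> \<Longrightarrow> poly_rel (Polynomial.monom x n) (Polynomial.monom y n)"
  by (simp add: poly_rel_def Rats)

lemma poly_rel_const: "(x, y) \<in> \<Gamma> \<Longrightarrow> poly_rel [:x:] [:y:]"
  using poly_rel_monom[of x y 0] by (simp add: monom_0)

lemma poly_rel_of_int: "poly_rel (map_poly of_int p) (map_poly of_int p)"
  by (simp add: poly_rel_def coeff_map_poly Rats)

lemma poly_rel_zero: "poly_rel 0 q \<Longrightarrow> q = 0"
  by (auto simp: poly_rel_def poly_eq_iff intro: zero)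

lemma poly_graph:
  assumes "poly_rel p q" "(x, y) \<in> \<Gamma>"
  shows "(poly p x, poly q y) \<in> \<Gamma>"
proof -
  have pow: "(x ^ n, y ^ n) \<in> \<Gamma>" for n
    by (induction n) (auto intro: Rats mult assms(2))
  \<comment> \<open>A common summation range for both values lets the graph property be applied term
    by term.\<close>
  define n where "n = max (Polynomial.degree p) (Polynomial.degree q)"
  have "poly p x = (\<Sum>i\<le>n. Polynomial.coeff p i * x ^ i)" "poly q y = (\<Sum>i\<le>n. Polynomial.coeff q i * y ^ i)"
    by (auto simp: poly_altdef n_def intro!: sum.mono_neutral_left coeff_eq_0)
  then show ?thesis
    by (simp add: sum mult pow poly_relD[OF assms(1)])
qed

text \<open>A nonzero algebraic \<open>x\<close> is a root of an integer polynomial with nonzero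
  constant term. If \<open>x\<close> were sent to 0, applying the homomorphism to this equation
  would send 0 to that constant term.\<close>

lemma inj_zero:
  assumes "(x, 0) \<in> \<Gamma>"
  shows "x = 0"
proof (rule ccontr)
  assume "x \<noteq> 0"
  with alg[OF assms] obtain p where p: "Polynomial.coeff p 0 \<noteq> 0" "poly (map_poly of_int p) x = 0"
    by (rule algebraicE'_nonzero)
  have "(poly (map_poly of_int p) x, poly (map_poly of_int p) 0) \<in> \<Gamma>"
    by (rule poly_graph[OF poly_rel_of_int assms])
  with p(2) have "(0, of_int (Polynomial.coeff p 0)) \<in> \<Gamma>"
    by (simp add: poly_0_coeff_0 coeff_map_poly)
  from zero[OF this] p(1) show False
    by simp
qed

lemma algebraic_poly:
  assumes "poly_rel p q" "algebraic z"
  shows "algebraic (poly p z)"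
  unfolding poly_altdef
  by (intro algebraic_sum algebraic_mult algebraic_power assms(2) alg[OF poly_relD[OF assms(1)]])

text \<open>The usual adjunction of one element: \<open>z\<close> is sent to a root \<open>w\<close>
  of the image \<open>q0\<close> of a polynomial \<open>p0\<close> of least degree that vanishes at
  \<open>z\<close>. The domain of \<Gamma> is only a ring, so \<open>p0\<close> cannot be made
  monic.\<close>

lemma extension:
  assumes "algebraic z"
  obtains \<Delta> where "ring_graph \<Delta>" "\<Gamma> \<subseteq> \<Delta>" "z \<in> Domain \<Delta>"
proof -
  let ?P = "\<lambda>n. \<exists>p q. poly_rel p q \<and> p \<noteq> 0 \<and> poly p z = 0 \<and> Polynomial.degree p = n"
  obtain r where "r \<noteq> 0" "poly (map_poly of_int r) z = 0"
    using algebraicE'[OF assms] .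
  then have "?P (Polynomial.degree (map_poly complex_of_int r))"
    by (intro exI[of _ "map_poly of_int r"]) (simp add: poly_rel_of_int map_poly_of_int_eq_0_iff)
  then have "?P (LEAST n. ?P n)"
    by (rule LeastI)
  then obtain p0 q0 where p0: "poly_rel p0 q0" "p0 \<noteq> 0" "poly p0 z = 0"
    and deg: "Polynomial.degree p0 = (LEAST n. ?P n)"
    by blast
  have min: "p = 0" if "poly_rel p q" "poly p z = 0" "Polynomial.degree p < Polynomial.degree p0" for p q
    using not_less_Least[of "Polynomial.degree p" ?P] that deg by auto
  define n where "n = Polynomial.degree p0"
  define a where "a = Polynomial.coeff p0 n"
  define b where "b = Polynomial.coeff q0 n"
  have ab: "(a, b) \<in> \<Gamma>"
    unfolding a_def b_def by (rule poly_relD[OF p0(1)])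
  have "a \<noteq> 0"
    using p0(2) by (simp add: a_def n_def)
  with ab inj_zero have "b \<noteq> 0"
    by auto
  have "n \<noteq> 0"
  proof
    assume "n = 0"
    then obtain c where "p0 = [:c:]"
      by (auto simp: n_def elim: degree_eq_zeroE)
    with p0 show False
      by simp
  qed
  \<comment> \<open>The coefficient \<open>b\<close> of \<open>q0\<close> at the positive index
    \<open>n\<close> is nonzero, so \<open>q0\<close> is not constant and has a complex
    root.\<close>
  then have "Polynomial.degree q0 \<noteq> 0"
    using \<open>b \<noteq> 0\<close> le_degree[of q0 n] by (auto simp: b_def)
  then obtain w where w: "poly q0 w = 0"
    using alg_closed_imp_poly_has_root[of q0] by blast
  \<comment> \<open>Pseudo-division by \<open>p0\<close>, carried out in parallel on both sides of the graph.\<close>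
  have root: "poly q w = 0" if "poly_rel p q" "poly p z = 0" for p q
    using that
  proof (induction "Polynomial.degree p" arbitrary: p q rule: less_induct)
    case less
    show ?case
    proof (cases "Polynomial.degree p < n")
      case True
      then show ?thesis
        using min[OF less.prems] poly_rel_zero[of q] less.prems by (simp add: n_def)
    next
      case False
      define k where "k = Polynomial.degree p - n"
      define c where "c = Polynomial.coeff p (Polynomial.degree p)"
      define d where "d = Polynomial.coeff q (Polynomial.degree p)"
      have cd: "(c, d) \<in> \<Gamma>"
        unfolding c_def d_def by (rule poly_relD[OF less.prems(1)])
      define p' where "p' = [:a:] * p - Polynomial.monom c k * p0"
      define q' where "q' = [:b:] * q - Polynomial.monom d k * q0"
      have rel: "poly_rel p' q'"
        unfolding p'_def q'_def
        by (intro poly_rel_diff poly_rel_mult poly_rel_const poly_rel_monom less.prems p0 ab cd)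
      have z: "poly p' z = 0"
        using less.prems p0 by (simp add: p'_def)
      \<comment> \<open>The leading terms of \<open>[:a:] * p\<close> and
        \<open>monom c k * p0\<close> are both \<open>a * c\<close> in degree
        \<open>degree p\<close> and cancel.\<close>
      have "Polynomial.degree p' < Polynomial.degree p"
      proof (rule degree_lessI)
        show "p' \<noteq> 0 \<or> 0 < Polynomial.degree p"
          using False \<open>n \<noteq> 0\<close> by simp
        show "\<forall>i\<ge>Polynomial.degree p. Polynomial.coeff p' i = 0"
        proof (intro allI impI)
          fix i assume i: "Polynomial.degree p \<le> i"
          show "Polynomial.coeff p' i = 0"
          proof (cases "i = Polynomial.degree p")
            case True
            then show ?thesis
              using False by (simp add: p'_def coeff_monom_mult a_def c_def k_def)
          next
            case ne: False
            then show ?thesis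
              using i False by (simp add: p'_def coeff_monom_mult k_def n_def coeff_eq_0)
          qed
        qed
      qed
      from less.hyps[OF this rel z] have "b * poly q w = 0"
        using w by (simp add: q'_def)
      with \<open>b \<noteq> 0\<close> show ?thesis
        by simp
    qed
  qed
  \<comment> \<open>This is the graph of the map from \<open>p(z)\<close> to \<open>q(w)\<close>;
    the fact \<open>root\<close> makes it single-valued.\<close>
  define \<Delta> where "\<Delta> = {(poly p z, poly q w) | p q. poly_rel p q}"
  have memI: "(u, v) \<in> \<Delta>" if "poly_rel p q" "u = poly p z" "v = poly q w" for p q u v
    using that by (auto simp: \<Delta>_def)
  have DeltaE: thesis if "(u, v) \<in> \<Delta>" "\<And>p q. poly_rel p q \<Longrightarrow> u = poly p z \<Longrightarrow> v = poly q w \<Longrightarrow> thesis" for u v thesis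
    using that by (auto simp: \<Delta>_def)
  show ?thesis
  proof
    show "ring_graph \<Delta>"
    proof
      show "(r, r) \<in> \<Delta>" if "r \<in> \<rat>" for r
        by (rule memI[OF poly_rel_const[OF Rats[OF that]]]) simp_all
      show "(x + x', y + y') \<in> \<Delta>" if "(x, y) \<in> \<Delta>" "(x', y') \<in> \<Delta>" for x y x' y'
        using that by (elim DeltaE) (rule memI[OF poly_rel_add], simp_all)
      show "(x * x', y * y') \<in> \<Delta>" if "(x, y) \<in> \<Delta>" "(x', y') \<in> \<Delta>" for x y x' y'
        using that by (elim DeltaE) (rule memI[OF poly_rel_mult], simp_all)
      show "algebraic x" if "(x, y) \<in> \<Delta>" for x y
        using that algebraic_poly assms by (auto simp: \<Delta>_def)
      show "y = 0" if "(0, y) \<in> \<Delta>" for y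
        using that root by (auto simp: \<Delta>_def)
    qed
    show "\<Gamma> \<subseteq> \<Delta>"
      by (auto intro: memI[OF poly_rel_const])
    \<comment> \<open>The polynomial X, which is related to itself, evaluates to \<open>z\<close>
      and \<open>w\<close>.\<close>
    have "(z, w) \<in> \<Delta>"
      by (rule memI[OF poly_rel_monom[OF Rats, of 1 1]]) (simp_all add: poly_monom)
    then show "z \<in> Domain \<Delta>"
      by blast
  qed
qed

end

section \<open>Maximal ring graphs by Zorn's lemma\<close>

lemma ring_graph_Union:
  assumes "\<C> \<noteq> {}" "subset.chain {\<Gamma>. ring_graph \<Gamma>} \<C>"
  shows "ring_graph (\<Union>\<C>)"
proof -
  have graph: "ring_graph \<Gamma>" if "\<Gamma> \<in> \<C>" for \<Gamma>
    using assms(2) that by (auto simp: subset.chain_def)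
  \<comment> \<open>In a chain any two pairs lie in a common member, where the sum and product rules
    can be applied.\<close>
  have common: "\<exists>\<Gamma>\<in>\<C>. u \<in> \<Gamma> \<and> v \<in> \<Gamma>" if "u \<in> \<Union>\<C>" "v \<in> \<Union>\<C>" for u v
  proof -
    from that obtain \<Gamma> \<Delta> where mem: "\<Gamma> \<in> \<C>" "u \<in> \<Gamma>" "\<Delta> \<in> \<C>" "v \<in> \<Delta>"
      by blast
    with assms(2) have "\<Gamma> \<subseteq> \<Delta> \<or> \<Delta> \<subseteq> \<Gamma>"
      by (auto simp: subset_chain_def)
    with mem show ?thesis
      by blast
  qed
  show ?thesis
  proof
    show "(r, r) \<in> \<Union>\<C>" if "r \<in> \<rat>" for r
      using assms(1) graph ring_graph.Rats[OF _ that] by blast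
    show "(x + x', y + y') \<in> \<Union>\<C>" if "(x, y) \<in> \<Union>\<C>" "(x', y') \<in> \<Union>\<C>" for x y x' y'
    proof -
      from common[OF that] obtain \<Gamma> where "\<Gamma> \<in> \<C>" "(x, y) \<in> \<Gamma>" "(x', y') \<in> \<Gamma>"
        by blast
      with ring_graph.add[OF graph] show ?thesis
        by blast
    qed
    show "(x * x', y * y') \<in> \<Union>\<C>" if "(x, y) \<in> \<Union>\<C>" "(x', y') \<in> \<Union>\<C>" for x y x' y'
    proof -
      from common[OF that] obtain \<Gamma> where "\<Gamma> \<in> \<C>" "(x, y) \<in> \<Gamma>" "(x', y') \<in> \<Gamma>"
        by blast
      with ring_graph.mult[OF graph] show ?thesis
        by blast
    qed
  qed (use graph ring_graph.alg ring_graph.zero in blast)+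
qed

text \<open>A maximal graph above \<Gamma> is defined at every algebraic number, since
  \<open>extension\<close> would enlarge it otherwise.\<close>

lemma ring_graph_maximal:
  assumes "ring_graph \<Gamma>"
  obtains \<Delta> where "ring_graph \<Delta>" "\<Gamma> \<subseteq> \<Delta>" "Domain \<Delta> = {z. algebraic z}"
proof -
  define \<A> where "\<A> = {\<Delta>. ring_graph \<Delta> \<and> \<Gamma> \<subseteq> \<Delta>}"
  have "\<exists>M\<in>\<A>. \<forall>Y\<in>\<A>. M \<subseteq> Y \<longrightarrow> Y = M"
  proof (rule subset_Zorn_nonempty)
    show "\<A> \<noteq> {}"
      using assms by (auto simp: \<A>_def)
    fix \<C> assume C: "\<C> \<noteq> {}" "subset.chain \<A> \<C>"
    then have "subset.chain {\<Delta>. ring_graph \<Delta>} \<C>"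
      by (auto simp: subset_chain_def \<A>_def)
    moreover have "\<Gamma> \<subseteq> \<Union>\<C>"
      using C unfolding subset_chain_def \<A>_def by blast
    ultimately show "\<Union>\<C> \<in> \<A>"
      using ring_graph_Union[OF C(1)] by (simp add: \<A>_def)
  qed
  then obtain M where M: "ring_graph M" "\<Gamma> \<subseteq> M"
    and max: "\<And>Y. ring_graph Y \<Longrightarrow> \<Gamma> \<subseteq> Y \<Longrightarrow> M \<subseteq> Y \<Longrightarrow> Y = M"
    by (auto simp: \<A>_def)
  have "z \<in> Domain M" if z: "algebraic z" for z
  proof -
    from ring_graph.extension[OF M(1) z] obtain Y where Y: "ring_graph Y" "M \<subseteq> Y" "z \<in> Domain Y" .
    with M(2) have "Y = M"
      by (intro max) auto
    with Y(3) show ?thesis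
      by simp
  qed
  then have "Domain M = {z. algebraic z}"
    using ring_graph.alg[OF M(1)] by auto
  with M show thesis
    by (rule that)
qed

section \<open>From ring graphs to Galois automorphisms\<close>

lemma carrier_Qbar: "carrier Qbar = {z. algebraic z}"
  by (simp add: Qbar_def)

text \<open>Closure under the map is part of bijectivity, and preservation of 1 is part of fixing
  \<rat>.\<close>

lemma carrier_GalQ_iff:
  "\<sigma> \<in> carrier GalQ \<longleftrightarrow> \<sigma> \<in> extensional {z. algebraic z} \<and>
     bij_betw \<sigma> {z. algebraic z} {z. algebraic z} \<and>
     (\<forall>x y. algebraic x \<longrightarrow> algebraic y \<longrightarrow> \<sigma> (x + y) = \<sigma> x + \<sigma> y \<and> \<sigma> (x * y) = \<sigma> x * \<sigma> y) \<and>
     (\<forall>x\<in>\<rat>. \<sigma> x = x)"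
  by (auto simp: GalQ_def Bij_def carrier_Qbar ring_hom_def Qbar_def ring_of_type_algebra_def
      dest: bij_betwE)

text \<open>A graph with full domain is an injective endomorphism. It is onto because it maps the
  finite set of roots of each nonzero integer polynomial injectively into itself.\<close>

lemma ring_graph_automorphism:
  assumes "ring_graph \<Gamma>"
  obtains \<sigma> where "\<sigma> \<in> carrier GalQ" "\<And>x y. (x, y) \<in> \<Gamma> \<Longrightarrow> \<sigma> x = y"
proof -
  from ring_graph_maximal[OF assms] obtain \<Delta>
    where \<Delta>: "ring_graph \<Delta>" "\<Gamma> \<subseteq> \<Delta>" and dom: "Domain \<Delta> = {z. algebraic z}" .
  interpret ring_graph \<Delta>
    by (rule \<Delta>)
  define \<sigma> where "\<sigma> = restrict (\<lambda>x. THE y. (x, y) \<in> \<Delta>) {z. algebraic z}"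
  have eq: "\<sigma> x = y" if "(x, y) \<in> \<Delta>" for x y
    using that functional alg[OF that] by (auto simp: \<sigma>_def)
  have graph: "(x, \<sigma> x) \<in> \<Delta>" if "algebraic x" for x
  proof -
    from that dom obtain y where "(x, y) \<in> \<Delta>"
      by blast
    with eq show ?thesis
      by auto
  qed
  have hom: "\<sigma> (x + y) = \<sigma> x + \<sigma> y" "\<sigma> (x * y) = \<sigma> x * \<sigma> y" if "algebraic x" "algebraic y" for x y
    using that by (auto intro!: eq add mult graph)
  have inj: "inj_on \<sigma> {z. algebraic z}"
  proof (rule inj_onI, clarify)
    fix x y assume "algebraic x" "algebraic y" "\<sigma> x = \<sigma> y"
    then show "x = y"
      using diff[OF graph graph, of x y] inj_zero[of "x - y"] by simp
  qed
  have roots: "poly (map_poly of_int p) (\<sigma> x) = 0"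
    if "algebraic x" "poly (map_poly of_int p) x = 0" for p x
    using zero[of "poly (map_poly of_int p) (\<sigma> x)"] poly_graph[OF poly_rel_of_int[of p] graph[OF that(1)]] that(2)
    by simp
  have algebraic_root: "algebraic x" if "p \<noteq> 0" "poly (map_poly of_int p) x = 0" for p and x :: complex
    by (rule algebraicI[of "map_poly of_int p"]) (use that in \<open>auto simp: coeff_map_poly map_poly_of_int_eq_0_iff\<close>)
  have bij: "\<sigma> ` {z. algebraic z} = {z. algebraic z}"
  proof (intro equalityI subsetI; clarify)
    fix x assume "algebraic (x :: complex)"
    then obtain p where "p \<noteq> 0" "poly (map_poly of_int p) x = 0"
      by (rule algebraicE')
    then show "algebraic (\<sigma> x)"
      using roots \<open>algebraic x\<close> algebraic_root by blast
  next
    fix y assume "algebraic (y :: complex)"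
    then obtain p where p: "p \<noteq> 0" "poly (map_poly of_int p) y = 0"
      by (rule algebraicE')
    define R where "R = {x :: complex. poly (map_poly of_int p) x = 0}"
    have "finite R"
      unfolding R_def using p(1) by (intro poly_roots_finite) (simp add: map_poly_of_int_eq_0_iff)
    moreover have alg: "R \<subseteq> {z. algebraic z}"
      using algebraic_root p(1) by (auto simp: R_def)
    moreover have "\<sigma> ` R \<subseteq> R"
      using roots alg by (auto simp: R_def)
    ultimately have "\<sigma> ` R = R"
      by (intro endo_inj_surj inj_on_subset[OF inj])
    moreover have "y \<in> R"
      using p(2) by (simp add: R_def)
    ultimately show "y \<in> \<sigma> ` {z. algebraic z}"
      using alg by blast
  qed
  show thesis
  proof
    show "\<sigma> \<in> carrier GalQ"
      unfolding carrier_GalQ_iff bij_betw_def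
      using inj bij hom eq Rats by (auto simp: \<sigma>_def)
    show "\<sigma> x = y" if "(x, y) \<in> \<Gamma>" for x y
      using that \<Delta>(2) eq by auto
  qed
qed

text \<open>The nontrivial automorphism of the quadratic field \<rat>(s) extends to all algebraic
  numbers; \<Gamma> is its graph. Irrationality of \<open>s\<close> makes the coordinates
  \<open>a\<close>, \<open>b\<close> unique.\<close>

lemma ex_GalQ_uminus:
  fixes s :: complex
  assumes "s\<^sup>2 \<in> \<rat>" "s \<notin> \<rat>"
  shows "\<exists>\<sigma>\<in>carrier GalQ. \<sigma> s = - s"
proof -
  have s: "algebraic s"
    by (rule algebraicI'[of "[:- s\<^sup>2, 0, 1:]"])
      (use assms in \<open>auto simp: coeff_pCons power2_eq_square split: nat.split\<close>)
  define \<Gamma> where "\<Gamma> = {(a + b * s, a - b * s) | a b. a \<in> \<rat> \<and> b \<in> \<rat>}"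
  have memI: "(x, y) \<in> \<Gamma>" if "a \<in> \<rat>" "b \<in> \<rat>" "x = a + b * s" "y = a - b * s" for a b x y
    using that by (auto simp: \<Gamma>_def)
  have "ring_graph \<Gamma>"
  proof
    show "(r, r) \<in> \<Gamma>" if "r \<in> \<rat>" for r
      by (rule memI[of r 0]) (use that in auto)
    show "(x + x', y + y') \<in> \<Gamma>" if xy: "(x, y) \<in> \<Gamma>" "(x', y') \<in> \<Gamma>" for x y x' y'
    proof -
      from xy obtain a b a' b' where ab: "a \<in> \<rat>" "b \<in> \<rat>" "a' \<in> \<rat>" "b' \<in> \<rat>"
        "x = a + b * s" "y = a - b * s" "x' = a' + b' * s" "y' = a' - b' * s"
        by (auto simp: \<Gamma>_def)
      show ?thesis
        by (rule memI[of "a + a'" "b + b'"]) (use ab in \<open>auto simp: algebra_simps\<close>)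
    qed
    show "(x * x', y * y') \<in> \<Gamma>" if xy: "(x, y) \<in> \<Gamma>" "(x', y') \<in> \<Gamma>" for x y x' y'
    proof -
      from xy obtain a b a' b' where ab: "a \<in> \<rat>" "b \<in> \<rat>" "a' \<in> \<rat>" "b' \<in> \<rat>"
        "x = a + b * s" "y = a - b * s" "x' = a' + b' * s" "y' = a' - b' * s"
        by (auto simp: \<Gamma>_def)
      show ?thesis
        by (rule memI[of "a * a' + b * b' * s\<^sup>2" "a * b' + a' * b"])
          (use ab assms in \<open>auto simp: algebra_simps power2_eq_square\<close>)
    qed
    show "algebraic x" if "(x, y) \<in> \<Gamma>" for x y
      using that s by (auto simp: \<Gamma>_def intro!: algebraic_add algebraic_mult intro: rat_imp_algebraic)
    show "y = 0" if xy: "(0, y) \<in> \<Gamma>" for y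
    proof -
      from xy obtain a b where ab: "a \<in> \<rat>" "b \<in> \<rat>" "a + b * s = 0" "y = a - b * s"
        by (auto simp: \<Gamma>_def)
      have "b = 0"
      proof (rule ccontr)
        assume "b \<noteq> 0"
        with ab(3) have "s = - a / b"
          by (simp add: field_simps add_eq_0_iff)
        with ab assms(2) show False
          by simp
      qed
      with ab show ?thesis
        by simp
    qed
  qed
  moreover have "(s, - s) \<in> \<Gamma>"
    by (rule memI[of 0 1]) auto
  ultimately show ?thesis
    by (meson ring_graph_automorphism)
qed

section \<open>Pointwise rules for Galois automorphisms\<close>

lemma
  assumes "\<sigma> \<in> carrier GalQ"
  shows GalQ_add: "algebraic x \<Longrightarrow> algebraic y \<Longrightarrow> \<sigma> (x + y) = \<sigma> x + \<sigma> y"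
    and GalQ_mult: "algebraic x \<Longrightarrow> algebraic y \<Longrightarrow> \<sigma> (x * y) = \<sigma> x * \<sigma> y"
    and GalQ_Rats: "r \<in> \<rat> \<Longrightarrow> \<sigma> r = r"
  using assms by (simp_all add: carrier_GalQ_iff)

lemma GalQ_of_int_mult: "\<sigma> \<in> carrier GalQ \<Longrightarrow> algebraic x \<Longrightarrow> \<sigma> (of_int k * x) = of_int k * \<sigma> x"
  by (simp add: GalQ_mult GalQ_Rats rat_imp_algebraic)

lemma GalQ_compose:
  assumes "\<sigma> \<in> carrier GalQ" "\<tau> \<in> carrier GalQ" "algebraic x"
  shows "(\<sigma> \<otimes>\<^bsub>GalQ\<^esub> \<tau>) x = \<sigma> (\<tau> x)"
  using assms by (simp add: GalQ_def BijGroup_def compose_def carrier_Qbar)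

lemma GalQ_ii:
  assumes "\<sigma> \<in> carrier GalQ"
  shows "\<sigma> \<i> = \<i> \<or> \<sigma> \<i> = - \<i>"
proof -
  have "\<sigma> \<i> * \<sigma> \<i> = \<i> * \<i>"
    using GalQ_mult[OF assms, of \<i> \<i>] GalQ_Rats[OF assms, of "-1"] by simp
  then show ?thesis
    by (simp only: square_eq_iff)
qed

lemma cnj_Rats:
  assumes "r \<in> \<rat>"
  shows "cnj r = r"
proof -
  from assms obtain a b :: int where "r = of_int a / of_int b"
    by (auto elim: Rats_cases')
  then show ?thesis
    by simp
qed

lemma complex_conj_GalQ: "complex_conj \<in> carrier GalQ"
proof -
  have "bij_betw cnj {z. algebraic z} {z. algebraic z}"
    by (rule bij_betwI[of _ _ _ cnj]) auto
  then have "bij_betw complex_conj {z. algebraic z} {z. algebraic z}"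
    by (rule bij_betw_cong[THEN iffD1, rotated]) (simp add: complex_conj_def carrier_Qbar)
  then show ?thesis
    using cnj_Rats by (auto simp: carrier_GalQ_iff complex_conj_def carrier_Qbar algebraic_add algebraic_mult rat_imp_algebraic)
qed

section \<open>Dihedral representations\<close>

text \<open>For \<open>x = \<plusminus>t\<close> this is the quotient \<open>x / t\<close> read in
  \<open>'k\<close>. The default 0 supplies the vanishing entries of a signed permutation
  matrix.\<close>

definition root_sign :: "complex \<Rightarrow> complex \<Rightarrow> 'k::field" where
  "root_sign x t = (if x = t then 1 else if x = - t then - 1 else 0)"

abbreviation mat2 :: "'k \<Rightarrow> 'k \<Rightarrow> 'k \<Rightarrow> 'k \<Rightarrow> 'k::zero ^ 2 ^ 2" where
  "mat2 a b c d \<equiv> vector [vector [a, b], vector [c, d]]"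

text \<open>The columns hold the images of \<open>s\<close> and \<open>cnj s\<close>, so that
  composition becomes the matrix product in the same order.\<close>

definition dihedral_rep :: "complex \<Rightarrow> (complex \<Rightarrow> complex) \<Rightarrow> 'k::field ^ 2 ^ 2" where
  "dihedral_rep s \<sigma> = mat2
     (root_sign (\<sigma> s) s) (root_sign (\<sigma> (cnj s)) s)
     (root_sign (\<sigma> s) (cnj s)) (root_sign (\<sigma> (cnj s)) (cnj s))"

section \<open>Arithmetic of 2 x 2 matrices and signs\<close>

lemma mat2_mult:
  "mat2 a b c d ** mat2 a' b' c' d' =
     mat2 (a * a' + b * c') (a * b' + b * d') (c * a' + d * c') (c * b' + d * d' :: 'k::field)"
  by (simp add: vec_eq_iff forall_2 matrix_matrix_mult_def sum_2)

lemma mat2_vector_mult: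
  "mat2 a b c d *v vector [x, y] = (vector [a * x + b * y, c * x + d * y :: 'k::field] :: 'k ^ 2)"
  by (simp add: vec_eq_iff forall_2 matrix_vector_mult_def sum_2)

lemma vector_2_collapse: "vector [v $ 1, v $ 2] = (v :: 'k::zero ^ 2)"
  by (simp add: vec_eq_iff forall_2)

lemma root_sign_of_int:
  "a = 1 \<or> a = - 1 \<Longrightarrow> t \<noteq> 0 \<Longrightarrow> root_sign (of_int a * t) t = of_int a"
  by (auto simp: root_sign_def)

lemma root_sign_eq_0:
  "a = 1 \<or> a = - 1 \<Longrightarrow> t \<noteq> u \<Longrightarrow> t \<noteq> - u \<Longrightarrow> root_sign (of_int a * t) u = 0"
  by (auto simp: root_sign_def minus_equation_iff)

text \<open>All entries are 0, 1 or -1. Hence base change to the algebraic closure gives the same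
  construction, and absolute irreducibility is irreducibility over the larger field.\<close>

lemma map_matrix_dihedral_rep: "map_matrix to_ac (dihedral_rep s \<sigma>) = dihedral_rep s \<sigma>"
  by (simp add: vec_eq_iff forall_2 map_matrix_def dihedral_rep_def root_sign_def)

section \<open>Square roots of non-real elements of \<rat>(\<i>)\<close>

locale gaussian_sqrt =
  fixes s :: complex
  assumes Rats_Re: "of_real (Re (s\<^sup>2)) \<in> (\<rat> :: complex set)"
    and Rats_Im: "of_real (Im (s\<^sup>2)) \<in> (\<rat> :: complex set)"
    and Im_nonzero: "Im (s\<^sup>2) \<noteq> 0"
begin

lemma square_decomp: "s\<^sup>2 = of_real (Re (s\<^sup>2)) + of_real (Im (s\<^sup>2)) * \<i>"
  by (simp add: complex_eq_iff)

lemma algebraic: "algebraic s"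
proof -
  have "algebraic (of_real (Re (s\<^sup>2)) + of_real (Im (s\<^sup>2)) * \<i>)"
    by (intro algebraic_add algebraic_mult algebraic_ii rat_imp_algebraic Rats_Re Rats_Im)
  then have "algebraic (s\<^sup>2)"
    by (simp only: square_decomp[symmetric])
  then show ?thesis
    by (rule algebraic_root[of _ "Polynomial.monom 1 2"])
      (auto simp: poly_monom degree_monom_eq)
qed

lemma algebraic_cnj: "algebraic (cnj s)"
  using algebraic by simp

lemma nonzero: "s \<noteq> 0" "cnj s \<noteq> 0"
  using Im_nonzero by auto

lemma square_neq: "(cnj s)\<^sup>2 \<noteq> s\<^sup>2"
proof
  assume "(cnj s)\<^sup>2 = s\<^sup>2"
  then have "Im ((cnj s)\<^sup>2) = Im (s\<^sup>2)"
    by simp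
  then have "- Im (s\<^sup>2) = Im (s\<^sup>2)"
    by (simp add: power2_eq_square)
  with Im_nonzero show False
    by simp
qed

text \<open>Since \<open>s\<^sup>2\<close> is not real, it differs from its conjugate; this
  separates \<plusminus>s from \<plusminus>cnj s.\<close>

lemma distinct: "s \<noteq> cnj s" "s \<noteq> - cnj s" "cnj s \<noteq> s" "cnj s \<noteq> - s"
proof -
  have "x \<noteq> y" "x \<noteq> - y" if "y\<^sup>2 \<noteq> x\<^sup>2" for x y :: complex
    using that by auto
  from this[OF square_neq] this[OF square_neq[symmetric]]
  show "s \<noteq> cnj s" "s \<noteq> - cnj s" "cnj s \<noteq> s" "cnj s \<noteq> - s" .
qed

text \<open>An automorphism fixes the rational coordinates of \<open>s\<^sup>2\<close>, so it fixes
  \<open>s\<^sup>2\<close> or conjugates it according to its action on \<i>. The signs are integers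
  so that they can be read both in \<complex> and in the coefficient field.\<close>

lemma GalQ_cases:
  assumes \<sigma>: "\<sigma> \<in> carrier GalQ"
  obtains (diag) a b :: int where "a = 1 \<or> a = - 1" "b = 1 \<or> b = - 1" "\<sigma> \<i> = \<i>"
      "\<sigma> s = of_int a * s" "\<sigma> (cnj s) = of_int b * cnj s"
    | (anti) a b :: int where "a = 1 \<or> a = - 1" "b = 1 \<or> b = - 1" "\<sigma> \<i> = - \<i>"
      "\<sigma> s = of_int a * cnj s" "\<sigma> (cnj s) = of_int b * s"
proof -
  have sq: "(\<sigma> x)\<^sup>2 = \<sigma> (x\<^sup>2)" if "algebraic x" for x
    using GalQ_mult[OF \<sigma> that that] by (simp add: power2_eq_square)
  have root: "\<exists>a :: int. (a = 1 \<or> a = - 1) \<and> x = of_int a * y" if "x\<^sup>2 = y\<^sup>2" for x y :: complex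
    using that by (auto simp: power2_eq_iff intro: exI[of _ 1] exI[of _ "-1"])
  have im: "\<sigma> (of_real (Im (s\<^sup>2)) * \<i>) = of_real (Im (s\<^sup>2)) * \<sigma> \<i>"
    by (simp only: GalQ_mult[OF \<sigma> rat_imp_algebraic[OF Rats_Im] algebraic_ii] GalQ_Rats[OF \<sigma> Rats_Im])
  have im': "\<sigma> (of_real (- Im (s\<^sup>2)) * \<i>) = of_real (- Im (s\<^sup>2)) * \<sigma> \<i>"
    using Rats_Im by (simp only: of_real_minus Rats_minus_iff rat_imp_algebraic GalQ_mult[OF \<sigma> _ algebraic_ii] GalQ_Rats[OF \<sigma>])
  have 1: "(\<sigma> s)\<^sup>2 = of_real (Re (s\<^sup>2)) + of_real (Im (s\<^sup>2)) * \<sigma> \<i>"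
    unfolding sq[OF algebraic] im[symmetric]
    by (subst (1) square_decomp)
      (simp only: GalQ_add[OF \<sigma>] GalQ_Rats[OF \<sigma>] Rats_Re Rats_Im algebraic_mult algebraic_ii rat_imp_algebraic)
  have cnj_decomp: "(cnj s)\<^sup>2 = of_real (Re (s\<^sup>2)) + of_real (- Im (s\<^sup>2)) * \<i>"
    by (simp add: complex_eq_iff power2_eq_square)
  have 2: "(\<sigma> (cnj s))\<^sup>2 = of_real (Re (s\<^sup>2)) + of_real (- Im (s\<^sup>2)) * \<sigma> \<i>"
    using Rats_Im unfolding sq[OF algebraic_cnj] im'[symmetric] cnj_decomp
    by (simp only: of_real_minus Rats_minus_iff GalQ_add[OF \<sigma>] GalQ_Rats[OF \<sigma>] Rats_Re algebraic_mult algebraic_ii rat_imp_algebraic)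
  show thesis
  proof (cases "\<sigma> \<i> = \<i>")
    case True
    then have "(\<sigma> s)\<^sup>2 = s\<^sup>2" "(\<sigma> (cnj s))\<^sup>2 = (cnj s)\<^sup>2"
      unfolding 1 2 cnj_decomp by (simp_all only: square_decomp[symmetric])
    then show thesis
      using root[of "\<sigma> s" s] root[of "\<sigma> (cnj s)" "cnj s"] diag[OF _ _ True] by blast
  next
    case False
    then have i: "\<sigma> \<i> = - \<i>"
      using GalQ_ii[OF \<sigma>] by simp
    have "(\<sigma> s)\<^sup>2 = (cnj s)\<^sup>2"
      unfolding 1 cnj_decomp i by simp
    moreover have "(\<sigma> (cnj s))\<^sup>2 = s\<^sup>2"
      unfolding 2 i by (subst (3) square_decomp) simp
    ultimately show thesis
      using root[of "\<sigma> s" "cnj s"] root[of "\<sigma> (cnj s)" s] anti[OF _ _ i] by blast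
  qed
qed

lemma rep_diag:
  assumes "a = 1 \<or> a = - 1" "b = 1 \<or> b = - 1" "\<sigma> s = of_int a * s" "\<sigma> (cnj s) = of_int b * cnj s"
  shows "dihedral_rep s \<sigma> = mat2 (of_int a) 0 0 (of_int b)"
  using assms(1,2) nonzero distinct
  by (simp only: dihedral_rep_def assms(3,4) root_sign_of_int root_sign_eq_0 not_False_eq_True)

lemma rep_anti:
  assumes "a = 1 \<or> a = - 1" "b = 1 \<or> b = - 1" "\<sigma> s = of_int a * cnj s" "\<sigma> (cnj s) = of_int b * s"
  shows "dihedral_rep s \<sigma> = mat2 0 (of_int b) (of_int a) 0"
  using assms(1,2) nonzero distinct
  by (simp only: dihedral_rep_def assms(3,4) root_sign_of_int root_sign_eq_0 not_False_eq_True)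

lemma rep_complex_conj: "dihedral_rep s complex_conj = mat2 0 1 1 0"
  using rep_anti[of 1 1 complex_conj] algebraic by (simp add: complex_conj_def carrier_Qbar)

lemma odd: "odd_rep (dihedral_rep s)"
  by (simp add: odd_rep_def rep_complex_conj det_2)

text \<open>Signs are rational, so \<open>\<sigma>\<close> passes through those produced by
  \<open>\<tau>\<close>; the four combinations of diagonal and antidiagonal matrices are then
  compared.\<close>

lemma rep_mult:
  assumes \<sigma>: "\<sigma> \<in> carrier GalQ" and \<tau>: "\<tau> \<in> carrier GalQ"
  shows "dihedral_rep s (\<sigma> \<otimes>\<^bsub>GalQ\<^esub> \<tau>) = dihedral_rep s \<sigma> ** dihedral_rep s \<tau>"
proof -
  note comp = GalQ_compose[OF \<sigma> \<tau> algebraic] GalQ_compose[OF \<sigma> \<tau> algebraic_cnj]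
    GalQ_of_int_mult[OF \<sigma> algebraic] GalQ_of_int_mult[OF \<sigma> algebraic_cnj]
  have sign: "a * a' = 1 \<or> a * a' = - 1" if "a = 1 \<or> a = - 1" "a' = 1 \<or> a' = - 1" for a a' :: int
    using that by auto
  from \<tau> show ?thesis
  proof (cases rule: GalQ_cases)
    case \<tau>: (diag a b)
    from \<sigma> show ?thesis
    proof (cases rule: GalQ_cases)
      case \<sigma>: (diag a' b')
      have "dihedral_rep s (\<sigma> \<otimes>\<^bsub>GalQ\<^esub> \<tau>) = mat2 (of_int (a' * a)) 0 0 (of_int (b' * b))"
        by (rule rep_diag) (use \<sigma> \<tau> in \<open>simp_all add: comp sign\<close>)
      then show ?thesis
        using \<sigma> \<tau> by (simp add: rep_diag[of a b] rep_diag[of a' b'] mat2_mult)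
    next
      case \<sigma>: (anti a' b')
      have "dihedral_rep s (\<sigma> \<otimes>\<^bsub>GalQ\<^esub> \<tau>) = mat2 0 (of_int (b' * b)) (of_int (a' * a)) 0"
        by (rule rep_anti) (use \<sigma> \<tau> in \<open>simp_all add: comp sign\<close>)
      then show ?thesis
        using \<sigma> \<tau> by (simp add: rep_diag[of a b] rep_anti[of a' b'] mat2_mult)
    qed
  next
    case \<tau>: (anti a b)
    from \<sigma> show ?thesis
    proof (cases rule: GalQ_cases)
      case \<sigma>: (diag a' b')
      have "dihedral_rep s (\<sigma> \<otimes>\<^bsub>GalQ\<^esub> \<tau>) = mat2 0 (of_int (a' * b)) (of_int (b' * a)) 0"
        by (rule rep_anti) (use \<sigma> \<tau> in \<open>simp_all add: comp sign\<close>)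
      then show ?thesis
        using \<sigma> \<tau> by (simp add: rep_anti[of a b] rep_diag[of a' b'] mat2_mult)
    next
      case \<sigma>: (anti a' b')
      have "dihedral_rep s (\<sigma> \<otimes>\<^bsub>GalQ\<^esub> \<tau>) = mat2 (of_int (b' * a)) 0 0 (of_int (a' * b))"
        by (rule rep_diag) (use \<sigma> \<tau> in \<open>simp_all add: comp sign\<close>)
      then show ?thesis
        using \<sigma> \<tau> by (simp add: rep_anti[of a b] rep_anti[of a' b'] mat2_mult)
    qed
  qed
qed

lemma rep_invertible:
  assumes "\<sigma> \<in> carrier GalQ"
  shows "invertible (dihedral_rep s \<sigma> :: 'k::field ^ 2 ^ 2)"
proof -
  have "det (dihedral_rep s \<sigma> :: 'k ^ 2 ^ 2) \<noteq> 0"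
    using assms by (cases rule: GalQ_cases) (auto simp: rep_diag rep_anti det_2)
  then show ?thesis
    by (simp add: invertible_det_nz)
qed

text \<open>The matrix depends only on the images of \<open>s\<close> and \<open>cnj s\<close>. It
  is therefore constant on each basic open set \<open>N \<sigma>\<close>, and every preimage is a
  union of such sets.\<close>

lemma continuous:
  "continuous_map krull_topology (discrete_topology (carrier GL))
     (dihedral_rep s :: _ \<Rightarrow> 'k::{field,finite} ^ 2 ^ 2)"
proof -
  define N where "N \<sigma> = {\<tau> \<in> carrier GalQ. \<forall>x\<in>{s, cnj s}. \<tau> x = \<sigma> x}" for \<sigma>
  have N: "openin krull_topology (N \<sigma>)" if "\<sigma> \<in> carrier GalQ" for \<sigma>
    unfolding krull_topology_def openin_topology_generated_by_iff N_def
    by (rule generate_topology_on.Basis)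
      (use that algebraic in \<open>auto simp: carrier_Qbar intro!: exI[of _ \<sigma>] exI[of _ "{s, cnj s}"]\<close>)
  have topspace: "topspace krull_topology \<subseteq> carrier GalQ"
    by (auto simp: krull_topology_def)
  have rep_N: "dihedral_rep s \<tau> = (dihedral_rep s \<sigma> :: 'k ^ 2 ^ 2)" if "\<tau> \<in> N \<sigma>" for \<sigma> \<tau>
    using that by (simp add: N_def dihedral_rep_def)
  show ?thesis
    unfolding continuous_map_def
  proof (intro conjI allI impI)
    show "dihedral_rep s \<in> topspace krull_topology \<rightarrow> topspace (discrete_topology (carrier GL))"
      using topspace rep_invertible by (auto simp: GL_def)
    fix U :: "('k ^ 2 ^ 2) set"
    have "{\<sigma> \<in> topspace krull_topology. dihedral_rep s \<sigma> \<in> U} =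
        (\<Union>\<sigma>\<in>{\<sigma> \<in> topspace krull_topology. dihedral_rep s \<sigma> \<in> U}. N \<sigma>)" (is "?L = ?R")
    proof
      show "?L \<subseteq> ?R"
        using topspace by (auto simp: N_def)
      show "?R \<subseteq> ?L"
      proof
        fix \<tau> assume "\<tau> \<in> ?R"
        then obtain \<sigma> where \<sigma>: "\<sigma> \<in> topspace krull_topology" "dihedral_rep s \<sigma> \<in> U" "\<tau> \<in> N \<sigma>"
          by blast
        with topspace N have "N \<sigma> \<subseteq> topspace krull_topology"
          by (intro openin_subset) auto
        with \<sigma> rep_N[OF \<sigma>(3)] show "\<tau> \<in> ?L"
          by auto
      qed
    qed
    also have "openin krull_topology \<dots>"
      using topspace N by (intro openin_Union) auto
    finally show "openin krull_topology {\<sigma> \<in> topspace krull_topology. dihedral_rep s \<sigma> \<in> U}" .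
  qed
qed

lemma galois_rep: "galois_rep (dihedral_rep s :: _ \<Rightarrow> 'k::{field,finite} ^ 2 ^ 2)"
  using continuous by (auto simp: galois_rep_def hom_def GL_def rep_invertible rep_mult)

text \<open>Complex conjugation swaps the coordinates, and an automorphism negating
  \<open>s * cnj s\<close> makes it possible to flip one sign. Adding a vector to its flip isolates
  twice the first coordinate, so a nonzero invariant subspace contains some \<open>(x, 0)\<close>
  with \<open>x \<noteq> 0\<close>, hence everything.\<close>

lemma irreducible:
  assumes irr: "s * cnj s \<notin> \<rat>" and two: "(2 :: 'k::field) \<noteq> 0"
  shows "irreducible_rep (dihedral_rep s :: _ \<Rightarrow> 'k ^ 2 ^ 2)"
  unfolding irreducible_rep_def
proof (intro allI impI, elim conjE)
  fix W :: "('k ^ 2) set"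
  assume W: "vec.subspace W" and inv: "\<forall>\<sigma>\<in>carrier GalQ. \<forall>w\<in>W. dihedral_rep s \<sigma> *v w \<in> W"
  have swap: "vector [y, x] \<in> W" if "vector [x, y] \<in> W" for x y
    using bspec[OF bspec[OF inv complex_conj_GalQ] that]
    by (simp add: rep_complex_conj mat2_vector_mult)
  \<comment> \<open>The square of \<open>s * cnj s\<close> is the norm of \<open>s\<^sup>2\<close>,
    a rational number, so \<open>ex_GalQ_uminus\<close> applies.\<close>
  have "(s * cnj s)\<^sup>2 = of_real (Re (s\<^sup>2)) ^ 2 + of_real (Im (s\<^sup>2)) ^ 2"
    by (simp add: complex_eq_iff power2_eq_square algebra_simps)
  also have "\<dots> \<in> \<rat>"
    using Rats_Re Rats_Im by (intro Rats_add Rats_power)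
  finally obtain \<sigma> where \<sigma>: "\<sigma> \<in> carrier GalQ" "\<sigma> (s * cnj s) = - (s * cnj s)"
    using ex_GalQ_uminus irr by blast
  then have \<sigma>': "\<sigma> s * \<sigma> (cnj s) = - (s * cnj s)"
    by (simp add: GalQ_mult algebraic)
  have flip: "vector [x, - y] \<in> W" if xy: "vector [x, y] \<in> W" for x y
    using \<sigma>(1)
  proof (cases rule: GalQ_cases)
    case (diag a b)
    have "of_int (a * b) * (s * cnj s) = - (s * cnj s)"
      using \<sigma>' diag by (simp add: algebra_simps)
    then have "b = - a"
      using nonzero diag(1,2) by auto
    have "mat2 (of_int a) 0 0 (of_int b) *v vector [x, y] \<in> W"
      using bspec[OF bspec[OF inv \<sigma>(1)] xy] by (simp add: rep_diag[OF diag(1,2,4,5)])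
    \<comment> \<open>Multiplying by the sign \<open>a\<close> removes the ambiguity:
      \<open>a * a = 1\<close> and \<open>a * b = -1\<close>.\<close>
    then have "of_int a *s (mat2 (of_int a) 0 0 (of_int b) *v vector [x, y]) \<in> W"
      using W by (simp add: vec.subspace_scale)
    also have "of_int a *s (mat2 (of_int a) 0 0 (of_int b) *v vector [x, y]) = (vector [x, - y] :: 'k ^ 2)"
      using diag(1) \<open>b = - a\<close> by (auto simp: mat2_vector_mult vec_eq_iff forall_2)
    finally show ?thesis .
  next
    case (anti a b)
    have "of_int (a * b) * (s * cnj s) = - (s * cnj s)"
      using \<sigma>' anti by (simp add: algebra_simps)
    then have "b = - a"
      using nonzero anti(1,2) by auto
    have "mat2 0 (of_int b) (of_int a) 0 *v vector [x, y] \<in> W"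
      using bspec[OF bspec[OF inv \<sigma>(1)] xy] by (simp add: rep_anti[OF anti(1,2,4,5)])
    then have "of_int a *s (mat2 0 (of_int b) (of_int a) 0 *v vector [x, y]) \<in> W"
      using W by (simp add: vec.subspace_scale)
    also have "of_int a *s (mat2 0 (of_int b) (of_int a) 0 *v vector [x, y]) = (vector [- y, x] :: 'k ^ 2)"
      using anti(1) \<open>b = - a\<close> by (auto simp: mat2_vector_mult vec_eq_iff forall_2)
    finally show ?thesis
      by (rule swap)
  qed
  show "W = {0} \<or> W = UNIV"
  proof (rule disjCI)
    assume "W \<noteq> UNIV"
    have e1: "x = 0" if "vector [x, 0] \<in> W" for x
    proof (rule ccontr)
      assume "x \<noteq> 0"
      have "v \<in> W" for v
      proof -
        \<comment> \<open>The vector \<open>(x, 0)\<close> and its swap \<open>(0, x)\<close> span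
          the plane.\<close>
        have "(v $ 1 / x) *s vector [x, 0] + (v $ 2 / x) *s vector [0, x] \<in> W"
          using W that swap by (intro vec.subspace_add vec.subspace_scale) auto
        also have "(v $ 1 / x) *s vector [x, 0] + (v $ 2 / x) *s vector [0, x] = v"
          using \<open>x \<noteq> 0\<close> by (simp add: vec_eq_iff forall_2)
        finally show ?thesis .
      qed
      with \<open>W \<noteq> UNIV\<close> show False
        by blast
    qed
    have first: "x = 0" if xy: "vector [x, y] \<in> W" for x y
    proof -
      have "vector [x, y] + vector [x, - y] \<in> W"
        using W xy flip[OF xy] by (intro vec.subspace_add)
      also have "vector [x, y] + vector [x, - y] = (vector [2 * x, 0] :: 'k ^ 2)"
        by (simp add: vec_eq_iff forall_2)
      finally show ?thesis
        using e1[of "2 * x"] two by simp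
    qed
    have "v = 0" if "v \<in> W" for v
    proof -
      have "vector [v $ 1, v $ 2] \<in> W"
        using that by (simp only: vector_2_collapse)
      from first[OF this] first[OF swap[OF this]] show ?thesis
        by (simp add: vec_eq_iff forall_2)
    qed
    then show "W = {0}"
      using vec.subspace_0[OF W] by blast
  qed
qed

lemma absolutely_irreducible:
  assumes "s * cnj s \<notin> \<rat>" "(2 :: 'k::field) \<noteq> 0"
  shows "absolutely_irreducible_rep (dihedral_rep s :: _ \<Rightarrow> 'k ^ 2 ^ 2)"
proof -
  have "to_ac (2 :: 'k) \<noteq> 0"
    using assms(2) by (simp del: to_ac_numeral)
  then show ?thesis
    unfolding absolutely_irreducible_rep_def map_matrix_dihedral_rep
    by (intro irreducible assms(1)) simp
qed

end

section \<open>Eigenvalues\<close>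

lemma is_eigenvalue_diag: "is_eigenvalue (mat2 1 0 0 b) (1 :: 'k::field)"
  unfolding is_eigenvalue_def
  by (rule exI[of _ "vector [1, 0]"]) (simp add: mat2_vector_mult vec_eq_iff forall_2)

text \<open>The vector \<open>(1, a)\<close> is mapped to \<open>(b * a, a)\<close>, which is
  itself.\<close>

lemma is_eigenvalue_anti:
  assumes "b * a = (1 :: int)"
  shows "is_eigenvalue (mat2 0 (of_int b) (of_int a) 0) (1 :: 'k::field)"
proof -
  from assms have "of_int b * of_int a = (1 :: 'k)"
    by (simp flip: of_int_mult)
  then show ?thesis
    unfolding is_eigenvalue_def
    by (intro exI[of _ "vector [1, of_int a]"]) (simp add: mat2_vector_mult vec_eq_iff forall_2)
qed

lemma is_eigenvalue_dihedral_reps: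
  assumes "gaussian_sqrt s" "gaussian_sqrt t" "gaussian_sqrt (s * t)" and \<sigma>: "\<sigma> \<in> carrier GalQ"
  shows "is_eigenvalue (dihedral_rep s \<sigma>) (1 :: 'k::field) \<or> is_eigenvalue (dihedral_rep t \<sigma>) (1 :: 'k)
    \<or> is_eigenvalue (dihedral_rep (s * t) \<sigma>) (1 :: 'k)"
proof -
  interpret s: gaussian_sqrt s by fact
  interpret t: gaussian_sqrt t by fact
  interpret st: gaussian_sqrt "s * t" by fact
  have st: "\<sigma> (s * t) = \<sigma> s * \<sigma> t" "\<sigma> (cnj s * cnj t) = \<sigma> (cnj s) * \<sigma> (cnj t)"
    using \<sigma> by (simp_all add: GalQ_mult s.algebraic t.algebraic)
  from \<sigma> show ?thesis
  proof (cases rule: s.GalQ_cases)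
    case s: (diag a b)
    from \<sigma> show ?thesis
    proof (cases rule: t.GalQ_cases)
      case t: (diag a' b')
      \<comment> \<open>Three signs with product 1 cannot all be -1.\<close>
      have "a = 1 \<or> a' = 1 \<or> a * a' = 1"
        using s t by auto
      moreover have "dihedral_rep (s * t) \<sigma> = mat2 (of_int (a * a')) 0 0 (of_int (b * b') :: 'k)"
        by (rule st.rep_diag) (use s t in \<open>auto simp: st\<close>)
      ultimately show ?thesis
        unfolding s.rep_diag[OF s(1,2,4,5)] t.rep_diag[OF t(1,2,4,5)]
        by (elim disjE) (simp_all only: of_int_1 is_eigenvalue_diag simp_thms)
    \<comment> \<open>In the mixed case \<i> would be both fixed and negated.\<close>
    qed (use s in simp)
  next
    case s: (anti a b)
    from \<sigma> show ?thesis
    proof (cases rule: t.GalQ_cases)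
      case t: (anti a' b')
      \<comment> \<open>These are the factors by which \<open>\<sigma>\<close> acts on
        \<open>s * cnj s\<close>, on \<open>t * cnj t\<close> and on their product; again their
        product is 1.\<close>
      have "b * a = 1 \<or> b' * a' = 1 \<or> (b * b') * (a * a') = 1"
        using s t by auto
      moreover have "dihedral_rep (s * t) \<sigma> = mat2 0 (of_int (b * b')) (of_int (a * a') :: 'k) 0"
        by (rule st.rep_anti) (use s t in \<open>auto simp: st\<close>)
      ultimately show ?thesis
        unfolding s.rep_anti[OF s(1,2,4,5)] t.rep_anti[OF t(1,2,4,5)]
        by (elim disjE) (simp_all only: is_eigenvalue_anti simp_thms)
    qed (use s in simp)
  qed
qed

section \<open>Eigenvalues of direct sums\<close>

lemma is_eigenvalue_block_diag_left:
  fixes A :: "'k::field ^ 'm ^ 'm" and B :: "'k ^ 'n ^ 'n"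
  assumes "is_eigenvalue A c"
  shows "is_eigenvalue (block_diag A B) c"
proof -
  from assms obtain v where v: "v \<noteq> 0" "A *v v = c *s v"
    by (auto simp: is_eigenvalue_def)
  \<comment> \<open>An eigenvector of one block, extended by zero, is an eigenvector of the whole
    matrix.\<close>
  define w :: "'k ^ ('m + 'n)" where "w = (\<chi> i. case i of Inl a \<Rightarrow> v $ a | Inr b \<Rightarrow> 0)"
  have "w \<noteq> 0"
    using v(1) by (auto simp: w_def vec_eq_iff split: sum.split)
  moreover have "(block_diag A B *v w) $ i = (c *s w) $ i" for i
    using arg_cong[OF v(2), of "\<lambda>u :: 'k ^ 'm. u $ a" for a]
    by (cases i) (simp_all add: matrix_vector_mult_def block_diag_def w_def UNIV_Plus_UNIV[symmetric] sum.Plus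
        del: UNIV_Plus_UNIV)
  ultimately show ?thesis
    by (auto simp: is_eigenvalue_def vec_eq_iff)
qed

lemma is_eigenvalue_block_diag_right:
  fixes A :: "'k::field ^ 'm ^ 'm" and B :: "'k ^ 'n ^ 'n"
  assumes "is_eigenvalue B c"
  shows "is_eigenvalue (block_diag A B) c"
proof -
  from assms obtain v where v: "v \<noteq> 0" "B *v v = c *s v"
    by (auto simp: is_eigenvalue_def)
  define w :: "'k ^ ('m + 'n)" where "w = (\<chi> i. case i of Inl a \<Rightarrow> 0 | Inr b \<Rightarrow> v $ b)"
  have "w \<noteq> 0"
    using v(1) by (auto simp: w_def vec_eq_iff split: sum.split)
  moreover have "(block_diag A B *v w) $ i = (c *s w) $ i" for i
    using arg_cong[OF v(2), of "\<lambda>u :: 'k ^ 'n. u $ a" for a]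
    by (cases i) (simp_all add: matrix_vector_mult_def block_diag_def w_def UNIV_Plus_UNIV[symmetric] sum.Plus
        del: UNIV_Plus_UNIV)
  ultimately show ?thesis
    by (auto simp: is_eigenvalue_def vec_eq_iff)
qed

section \<open>Irrational square roots of norms\<close>

lemma Rats_square_eq_of_int:
  fixes x :: complex
  assumes "x \<in> \<rat>" "x\<^sup>2 = of_int n"
  obtains k :: int where "k\<^sup>2 = n"
proof -
  \<comment> \<open>As a root of the monic polynomial X^2 - n, \<open>x\<close> is an algebraic
    integer, and rational algebraic integers are integers.\<close>
  have "algebraic_int x"
    by (rule algebraic_int.intros[of "[:- of_int n, 0, 1:]"])
      (use assms in \<open>auto simp: coeff_pCons power2_eq_square split: nat.split\<close>)
  then have "x \<in> \<int>"
    using assms(1) by (rule rational_algebraic_int_is_int)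
  then obtain k where "x = of_int k"
    by (elim Ints_cases)
  with assms(2) have "k\<^sup>2 = n"
    by (simp flip: of_int_power)
  then show thesis
    by (rule that)
qed

text \<open>The hypothesis says that \<open>s * cnj s\<close> is a square root of \<open>n\<close>;
  the irrationality condition thus becomes a statement about integer squares.\<close>

lemma norm_sqrt_irrational:
  fixes s :: complex
  assumes "s\<^sup>2 * cnj (s\<^sup>2) = of_int n" "\<And>k :: int. k\<^sup>2 \<noteq> n"
  shows "s * cnj s \<notin> \<rat>"
proof
  assume "s * cnj s \<in> \<rat>"
  moreover have "(s * cnj s)\<^sup>2 = of_int n"
    using assms(1) by (simp add: power_mult_distrib)
  ultimately obtain k :: int where "k\<^sup>2 = n"
    by (rule Rats_square_eq_of_int)
  with assms(2) show False
    by blast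
qed

text \<open>Translation by 1 permutes the field, so the sum of all elements is unchanged when
  \<open>CARD('k)\<close> ones are added to it; hence \<open>CARD('k)\<close> vanishes in
  \<open>'k\<close>. If 2 vanished too, an odd cardinality would give 1 = 0.\<close>

lemma two_nonzero:
  assumes "odd CARD('k::{field,finite})"
  shows "(2 :: 'k) \<noteq> 0"
proof
  assume two: "(2 :: 'k) = 0"
  have "(\<Sum>x\<in>UNIV. x) = (\<Sum>x\<in>UNIV. x + 1 :: 'k)"
    by (rule sum.reindex_bij_witness[of _ "\<lambda>x. x + 1" "\<lambda>x. x - 1"]) auto
  then have "of_nat CARD('k) = (0 :: 'k)"
    by (simp add: sum.distrib)
  moreover obtain m where "CARD('k) = 2 * m + 1"
    using assms by (rule oddE)
  ultimately show False
    using two by simp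
qed

section \<open>The three representations\<close>

theorem proposition2p9:
  fixes p f q :: nat
  assumes "Factorial_Ring.prime p" and "f \<ge> 1" and "q = p ^ f" and "[q = 1] (mod 4)"
    and "CARD('k::{field,finite}) = q"
  shows "\<exists>\<rho>1 \<rho>2 \<rho>3 :: (complex \<Rightarrow> complex) \<Rightarrow> 'k ^ 2 ^ 2.
    (\<forall>\<rho>\<in>{\<rho>1, \<rho>2, \<rho>3}. galois_rep \<rho> \<and> odd_rep \<rho> \<and> absolutely_irreducible_rep \<rho>) \<and>
    (\<forall>m\<ge>1. \<not> (\<exists>l. orderly p m (\<rho>1 \<oplus>\<^sub>r \<rho>2 \<oplus>\<^sub>r \<rho>3) l))"
proof -
  have "q mod 4 = 1"
    using assms(4) by (simp add: cong_def)
  then have "odd CARD('k)"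
    unfolding assms(5) by presburger
  then have two: "(2 :: 'k) \<noteq> 0"
    by (rule two_nonzero)
  \<comment> \<open>The numbers 1 + 2\<i>, 1 + \<i> and their product -1 + 3\<i> are not real, and
    their norms 5, 2 and 10 are not squares.\<close>
  define s where "s = csqrt (1 + 2 * \<i>)"
  define t where "t = csqrt (1 + \<i>)"
  have squares: "s\<^sup>2 = 1 + 2 * \<i>" "t\<^sup>2 = 1 + \<i>" "(s * t)\<^sup>2 = - 1 + 3 * \<i>"
    by (simp_all add: s_def t_def power_mult_distrib algebra_simps)
  have sqrts: "gaussian_sqrt s" "gaussian_sqrt t" "gaussian_sqrt (s * t)"
    by (unfold_locales, unfold squares) simp_all
  have nonsquare: "k\<^sup>2 \<noteq> n" if "n \<in> {2, 5, 10}" for k n :: int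
  proof
    assume k: "k\<^sup>2 = n"
    \<comment> \<open>Each \<open>n\<close> is below 16, which leaves finitely many \<open>k\<close>
      to inspect.\<close>
    have "\<bar>k\<bar> < 4"
      by (rule power2_less_imp_less) (use k that in auto)
    then have "k \<in> {- 3, - 2, - 1, 0, 1, 2, 3}"
      by auto
    with k that show False
      by auto
  qed
  have "s * cnj s \<notin> \<rat>"
    by (rule norm_sqrt_irrational[OF _ nonsquare, of _ 5], unfold squares) (simp_all add: complex_eq_iff)
  moreover have "t * cnj t \<notin> \<rat>"
    by (rule norm_sqrt_irrational[OF _ nonsquare, of _ 2], unfold squares) (simp_all add: complex_eq_iff)
  moreover have "(s * t) * cnj (s * t) \<notin> \<rat>"
    by (rule norm_sqrt_irrational[OF _ nonsquare, of _ 10], unfold squares) (simp_all add: complex_eq_iff)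
  ultimately have irr: "s * cnj s \<notin> \<rat>" "t * cnj t \<notin> \<rat>" "(s * t) * cnj (s * t) \<notin> \<rat>" .
  define \<rho> where "\<rho> = (dihedral_rep :: complex \<Rightarrow> _ \<Rightarrow> 'k ^ 2 ^ 2)"
  have "\<forall>\<rho>'\<in>{\<rho> s, \<rho> t, \<rho> (s * t)}. galois_rep \<rho>' \<and> odd_rep \<rho>' \<and> absolutely_irreducible_rep \<rho>'"
    using sqrts irr two unfolding \<rho>_def
    by (auto intro: gaussian_sqrt.galois_rep gaussian_sqrt.odd gaussian_sqrt.absolutely_irreducible)
  moreover have "\<not> orderly p m (\<rho> s \<oplus>\<^sub>r \<rho> t \<oplus>\<^sub>r \<rho> (s * t)) l" for m l
  proof
    assume "orderly p m (\<rho> s \<oplus>\<^sub>r \<rho> t \<oplus>\<^sub>r \<rho> (s * t)) l"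
    \<comment> \<open>A Frobenius element lies in the Galois group, all of whose elements have the
      eigenvalue 1 in one of the summands.\<close>
    then obtain \<sigma> where \<sigma>: "\<sigma> \<in> carrier GalQ" "\<not> is_eigenvalue ((\<rho> s \<oplus>\<^sub>r \<rho> t \<oplus>\<^sub>r \<rho> (s * t)) \<sigma>) 1"
      by (auto simp: orderly_def frobenius_elements_def decomposition_group_def)
    moreover have "is_eigenvalue (\<rho> s \<sigma>) 1 \<or> is_eigenvalue (\<rho> t \<sigma>) 1 \<or> is_eigenvalue (\<rho> (s * t) \<sigma>) 1"
      unfolding \<rho>_def by (rule is_eigenvalue_dihedral_reps[OF sqrts \<sigma>(1)])
    ultimately show False
      unfolding direct_sum_rep_def
      by (blast intro: is_eigenvalue_block_diag_left is_eigenvalue_block_diag_right)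
  qed
  ultimately show ?thesis
    by blast
qed

end
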